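(* For $n \geq 1$, $\mathrm{snc}(n) \equiv 0 \pmod 2$ if and only if $n \equiv 3, 5,$ or $6 \pmod 7$.
   Context: The semi-Narayana cows sequence $\{\mathrm{snc}(n)\}_{n\ge0}$ is defined recursively by $\mathrm{snc}(0)=\mathrm{snc}(1)=1$, and for $n\ge1$: $\mathrm{snc}(2n)=\mathrm{snc}(n)$ and $\mathrm{snc}(2n+1)=\mathrm{snc}(2n)+\mathrm{snc}(2n-2)$. *)

theory Defs
  imports "HOL-Number_Theory.Cong"
begin

text \<open>The semi-Narayana cows sequence. For odd $n = 2m + 1$ with $m \ge 1$, the indices $n - 1$ and
  $n - 3$ are $2m$ and $2m - 2$; no subtraction truncates, as $n \ge 3$ in that branch.\<close>

fun snc :: "nat \<Rightarrow> nat" where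
  "snc n = (if n \<le> 1 then 1
            else if even n then snc (n div 2)
            else snc (n - 1) + snc (n - 3))"

declare snc.simps [simp del]

lemma snc_0: "snc 0 = 1"
  by (simp add: snc.simps)

lemma snc_1: "snc 1 = 1"
  by (simp add: snc.simps)

lemma snc_even: "n \<ge> 1 \<Longrightarrow> snc (2 * n) = snc n"
  by (subst snc.simps) simp

lemma snc_odd: "n \<ge> 1 \<Longrightarrow> snc (2 * n + 1) = snc (2 * n) + snc (2 * n - 2)"
proof -
  assume "n \<ge> 1"
  moreover have "2 * n + 1 - 3 = 2 * n - 2"
    by linarith
  ultimately show ?thesis
    by (subst snc.simps) auto
qed

end

theory Submission
  imports Defs
begin

text \<open>Modulo 2 the Narayana cows sequence, given by \<open>a (n) = a (n - 1) + a (n - 3)\<close> and three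
  initial values 1, has period 7 with parities \<open>1, 1, 1, 0, 1, 0, 0\<close>; its even terms sit at the
  residues 3, 5, 6. This set of residues is closed under doubling, being the set of quadratic
  non-residues modulo 7, so \<open>a (2 * n)\<close> and \<open>a (n)\<close> have the same parity. Hence the parity of
  \<open>a\<close> satisfies both defining rules of \<open>snc\<close>: the even rule is invariance under doubling, and the
  odd rule is the cows recurrence at an odd index. As the initial values agree, the two parities
  coincide. Strong induction carries this out with the parity pattern written as a condition on
  \<open>n mod 7\<close>.\<close>

text \<open>The residue 0 belongs to an odd value, in agreement with \<open>snc 0 = 1\<close>. Including this index
  keeps the induction uniform: the odd rule refers to index 0 when it computes \<open>snc 3\<close>.\<close>

lemma even_snc_iff_mod_7: "even (snc n) \<longleftrightarrow> n mod 7 \<in> {3, 5, 6}"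
proof (induction n rule: less_induct)
  case (less n)
  consider "n \<le> 1" | m where "n = 2 * m" "m \<ge> 1" | m where "n = 2 * m + 1" "m \<ge> 1"
  proof -
    have "n = 2 * (n div 2) \<or> n = 2 * (n div 2) + 1" and "n \<le> 1 \<or> n div 2 \<ge> 1"
      by linarith+
    then show ?thesis
      using that by blast
  qed
  then show ?case
  proof cases
    case 1
    then have "n = 0 \<or> n = 1"
      by linarith
    then show ?thesis
      using snc_0 snc_1 by auto
  next
    case (2 m)
    have "even (snc n) \<longleftrightarrow> m mod 7 \<in> {3, 5, 6}"
      using 2 less.IH[of m] by (simp add: snc_even)
    \<comment> \<open>2 is a square modulo 7, so doubling preserves the set of non-residues.\<close>
    also have "\<dots> \<longleftrightarrow> (2 * m) mod 7 \<in> {3, 5, 6}"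
    proof -
      have "m mod 7 \<in> {0, 1, 2, 3, 4, 5, 6}"
        by (simp, linarith)
      moreover have "(2 * m) mod 7 = (2 * (m mod 7)) mod 7"
        by (simp add: mod_simps)
      ultimately show ?thesis
        by auto
    qed
    finally show ?thesis
      using 2 by simp
  next
    case (3 m)
    have "even (snc n) \<longleftrightarrow> (even (snc (2 * m)) \<longleftrightarrow> even (snc (2 * m - 2)))"
      using 3 snc_odd[of m] by simp
    also have "\<dots> \<longleftrightarrow> ((2 * m) mod 7 \<in> {3, 5, 6} \<longleftrightarrow> (2 * m - 2) mod 7 \<in> {3, 5, 6})"
      using 3 less.IH[of "2 * m"] less.IH[of "2 * m - 2"] by simp
    \<comment> \<open>This is the cows recurrence modulo 2 for the periodic pattern. Writing \<open>m = k + 1\<close> removes the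
      truncating subtraction, which leaves a finite check over the residue of \<open>k\<close>.\<close>
    also have "\<dots> \<longleftrightarrow> (2 * m + 1) mod 7 \<in> {3, 5, 6}"
    proof -
      obtain k where "m = k + 1"
        using \<open>m \<ge> 1\<close> by (metis le_add_diff_inverse2)
      then have shifts: "2 * m - 2 = 2 * k + 0" "2 * m = 2 * k + 2" "2 * m + 1 = 2 * k + 3"
        by simp_all
      have reduce: "(2 * k + c) mod 7 = (2 * (k mod 7) + c) mod 7" for c
        by (metis mod_add_left_eq mod_mult_right_eq)
      have "k mod 7 \<in> {0, 1, 2, 3, 4, 5, 6}"
        by (simp, linarith)
      then show ?thesis
        unfolding shifts(1) shifts(3) unfolding shifts(2) reduce
        by (elim insertE emptyE) simp_all
    qed
    finally show ?thesis
      using 3 by simp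
  qed
qed

theorem theorem7p3:
  fixes n :: nat
  assumes "n \<ge> 1"
  shows "[snc n = 0] (mod 2) \<longleftrightarrow> [n = 3] (mod 7) \<or> [n = 5] (mod 7) \<or> [n = 6] (mod 7)"
  using even_snc_iff_mod_7[of n] by (simp add: cong_def even_iff_mod_2_eq_zero)

end
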